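(* Let $n\ge4$ and let $H$ be an arbitrary element of the Hilbert space $\mathscr H_n$. Then there exist points $v_1,\dots,v_n$ in a Euclidean space $\mathbb R^d$ with $d\le n-2$ such that the $\mathcal U$-centered Euclidean distance matrix of $v_1,\dots,v_n$, i.e. $\widetilde D$ for $D=(|v_i-v_j|)_{i,j}$, is exactly equal to $H$.
   Context: $\mathcal U$-centering: for a symmetric real $n\times n$ matrix $A=(a_{ij})$ with zero diagonal, $n>2$, the matrix $\widetilde A$ has entries $\widetilde A_{ii}=0$ and, for $i\neq j$, $$\widetilde A_{ij}=a_{ij}-\frac{1}{n-2}\sum_{\ell=1}^n a_{i\ell}-\frac{1}{n-2}\sum_{k=1}^n a_{kj}+\frac{1}{(n-1)(n-2)}\sum_{k,\ell=1}^n a_{k\ell}.$$ $\mathscr H_n$ is the real linear span of all matrices $\widetilde A$ where $A$ ranges over the Euclidean distance matrices $(|x_i-x_j|)_{i,j}$ of $n$-point sets in some $\mathbb R^p$, $p\ge1$ (equivalently, the set of $\widetilde A$ for $A$ in the linear span of such distance matrices), with inner product $(C\cdot D)=\frac{1}{n(n-3)}\sum_{i\ne j}C_{ij}D_{ij}$. *)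

theory Defs
  imports Complex_Main
begin

text \<open>Points of R^p are represented as functions nat => real, only the coordinates
  0..p-1 being relevant; matrices as functions nat => nat => real with indices 0..n-1.\<close>

definition edist :: "nat \<Rightarrow> (nat \<Rightarrow> real) \<Rightarrow> (nat \<Rightarrow> real) \<Rightarrow> real" where
  "edist p x y = sqrt (\<Sum>k<p. (x k - y k)^2)"

definition dist_matrix :: "nat \<Rightarrow> (nat \<Rightarrow> nat \<Rightarrow> real) \<Rightarrow> nat \<Rightarrow> nat \<Rightarrow> real" where
  "dist_matrix p v = (\<lambda>i j. edist p (v i) (v j))"

definition ucenter :: "nat \<Rightarrow> (nat \<Rightarrow> nat \<Rightarrow> real) \<Rightarrow> nat \<Rightarrow> nat \<Rightarrow> real" where
  "ucenter n A = (\<lambda>i j. if i < n \<and> j < n \<and> i \<noteq> j then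
      A i j - (\<Sum>l<n. A i l) / (real n - 2) - (\<Sum>k<n. A k j) / (real n - 2)
      + (\<Sum>k<n. \<Sum>l<n. A k l) / ((real n - 1) * (real n - 2))
    else 0)"

text \<open>The space H_n: the real linear span (finite linear combinations) of the U-centered
  Euclidean distance matrices of n-point sets in R^p, p >= 1.\<close>
definition Hspace :: "nat \<Rightarrow> (nat \<Rightarrow> nat \<Rightarrow> real) set" where
  "Hspace n = {H. \<exists>(m::nat) (c::nat \<Rightarrow> real) (p::nat \<Rightarrow> nat) (V::nat \<Rightarrow> nat \<Rightarrow> nat \<Rightarrow> real).
      (\<forall>t<m. 1 \<le> p t) \<and>
      H = (\<lambda>i j. \<Sum>t<m. c t * ucenter n (dist_matrix (p t) (V t)) i j)}"

end

theory Submission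
  imports Defs
begin

text \<open>Every element of \<open>\<H>\<^sub>n\<close> is the \<open>\<U>\<close>-centering of a symmetric matrix \<open>A\<close> with zero
  diagonal, and \<open>\<U>\<close>-centering annihilates every matrix of the form \<open>c + x\<^sub>i + x\<^sub>j\<close> (off the
  diagonal). It therefore suffices to choose \<open>c\<close> and \<open>x\<close> so that \<open>A\<^sub>i\<^sub>j + c + x\<^sub>i + x\<^sub>j\<close> is a
  Euclidean distance matrix of \<open>n\<close> points in \<open>\<real>\<^sup>n\<^sup>-\<^sup>2\<close>. With large shifts the matrix is a small
  perturbation of the distance matrix of a right-angled isosceles simplex, whose Gram matrix with
  respect to the corner is diagonally dominant, so all its Cholesky pivots are positive. Then the
  shift at one vertex is decreased until that vertex reaches the corner, where the last pivot is
  \<open>\<le> 0\<close>; by the intermediate value theorem the last pivot vanishes in between, and the Cholesky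
  factor at that moment is a Gram factorisation of rank \<open>n - 2\<close>.\<close>

subsection \<open>Cholesky factorisation\<close>

text \<open>The lower triangular Cholesky factor; it satisfies \<open>L L\<^sup>T = g\<close> only while the pivots stay
  positive, otherwise its entries are junk (square roots of negatives, division by \<open>0\<close>).\<close>

function chol :: "(nat \<Rightarrow> nat \<Rightarrow> real) \<Rightarrow> nat \<Rightarrow> nat \<Rightarrow> real" where
  "chol g i l = (if i < l then 0
     else if l = i then sqrt (g i i - (\<Sum>r<i. (chol g i r)^2))
     else (g i l - (\<Sum>r<l. chol g i r * chol g l r)) / chol g l l)"
  by auto
termination
  by (relation "inv_image (less_than <*lex*> less_than) (\<lambda>(g,i,l). (i,l))") auto

declare chol.simps[simp del]

definition chol_pivot :: "(nat \<Rightarrow> nat \<Rightarrow> real) \<Rightarrow> nat \<Rightarrow> real" where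
  "chol_pivot g i = g i i - (\<Sum>r<i. (chol g i r)^2)"

lemma chol_above: "i < l \<Longrightarrow> chol g i l = 0"
  by (subst chol.simps) simp

lemma chol_diag: "chol g i i = sqrt (chol_pivot g i)"
  by (subst chol.simps) (simp add: chol_pivot_def)

lemma chol_below:
  "l < i \<Longrightarrow> chol g i l = (g i l - (\<Sum>r<l. chol g i r * chol g l r)) / chol g l l"
  by (subst chol.simps) simp

lemma chol_cong:
  assumes "\<And>a b. a \<le> k \<Longrightarrow> b \<le> k \<Longrightarrow> g a b = g' a b" and "i \<le> k"
  shows "chol g i l = chol g' i l"
  using assms
proof (induction g i l rule: chol.induct)
  case (1 g i l)
  show ?case
    by (subst (1 2) chol.simps) (use 1 in \<open>auto intro!: sum.cong\<close>)
qed

lemma chol_pivot_cong: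
  assumes "\<And>a b. a \<le> k \<Longrightarrow> b \<le> k \<Longrightarrow> g a b = g' a b" and "i \<le> k"
  shows "chol_pivot g i = chol_pivot g' i"
  using chol_cong[OF assms] assms by (simp add: chol_pivot_def)

lemma chol_gram:
  assumes g_sym: "\<And>a b. g a b = g b a"
    and pos: "\<And>l. l < k \<Longrightarrow> chol_pivot g l > 0" and nonneg: "chol_pivot g k \<ge> 0"
    and "i \<le> k" "j \<le> k"
  shows "(\<Sum>r<Suc k. chol g i r * chol g j r) = g i j"
  using assms(4,5)
proof (induction i j rule: linorder_wlog)
  case (le a b)
  have "(\<Sum>r<Suc k. chol g a r * chol g b r) = (\<Sum>r<Suc a. chol g a r * chol g b r)"
    by (rule sum.mono_neutral_right) (use le in \<open>auto simp: chol_above\<close>)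
  also have "\<dots> = g a b"
  proof (cases "a = b")
    case True
    have "(sqrt (chol_pivot g a))^2 = chol_pivot g a"
      using pos[of a] nonneg le by (cases "a = k") auto
    then show ?thesis using True by (simp add: power2_eq_square chol_diag chol_pivot_def)
  next
    case False
    with le have "a < b" by simp
    have "chol g a a > 0" using pos[of a] le \<open>a < b\<close> by (simp add: chol_diag)
    then have "(\<Sum>r<Suc a. chol g b r * chol g a r) = g b a"
      by (simp add: chol_below[OF \<open>a < b\<close>])
    then show ?thesis by (simp add: mult.commute g_sym[of b a])
  qed
  finally show ?case .
next
  case (sym i j)
  then show ?case by (simp add: mult.commute g_sym[of i j])
qed

lemma abs_sum_mult_le:
  fixes x y :: "nat \<Rightarrow> real"
  assumes "\<And>r. r < l \<Longrightarrow> \<bar>x r\<bar> \<le> \<delta>" and "\<And>r. r < l \<Longrightarrow> \<bar>y r\<bar> \<le> \<delta>"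
  shows "\<bar>\<Sum>r<l. x r * y r\<bar> \<le> real l * \<delta>^2"
proof -
  have "\<bar>\<Sum>r<l. x r * y r\<bar> \<le> (\<Sum>r<l. \<bar>x r\<bar> * \<bar>y r\<bar>)"
    using sum_abs[of "\<lambda>r. x r * y r" "{..<l}"] by (simp add: abs_mult)
  also have "\<dots> \<le> (\<Sum>r<l. \<delta> * \<delta>)"
  proof (rule sum_mono)
    fix r assume "r \<in> {..<l}"
    then have "\<bar>x r\<bar> \<le> \<delta>" "\<bar>y r\<bar> \<le> \<delta>" using assms by auto
    then show "\<bar>x r\<bar> * \<bar>y r\<bar> \<le> \<delta> * \<delta>" by (meson abs_ge_zero mult_mono order_trans)
  qed
  finally show ?thesis by (simp add: power2_eq_square)
qed

lemma chol_diag_dominant: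
  assumes diag: "\<And>i. i < m \<Longrightarrow> g i i \<ge> \<gamma>"
    and off: "\<And>i j. i < m \<Longrightarrow> j < m \<Longrightarrow> i \<noteq> j \<Longrightarrow> \<bar>g i j\<bar> \<le> \<epsilon>"
    and q: "q > 0" and room: "real m * \<delta>^2 \<le> \<gamma> - q^2"
    and small: "\<epsilon> + real m * \<delta>^2 \<le> \<delta> * q"
    and "k < m"
  shows "chol_pivot g k \<ge> q^2 \<and> (\<forall>l<k. \<bar>chol g k l\<bar> \<le> \<delta>)"
  using \<open>k < m\<close>
proof (induction k rule: less_induct)
  case (less k)
  note pivot_IH = less.IH
  have low: "\<bar>chol g k l\<bar> \<le> \<delta>" if "l < k" for l
    using that
  proof (induction l rule: less_induct)
    case (less l)
    have "q \<le> chol g l l"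
      using pivot_IH[of l] less.prems \<open>k < m\<close> by (simp add: chol_diag real_le_rsqrt)
    have "\<bar>\<Sum>r<l. chol g k r * chol g l r\<bar> \<le> real l * \<delta>^2"
      using less pivot_IH[of l] \<open>k < m\<close> by (intro abs_sum_mult_le) auto
    also have "\<dots> \<le> real m * \<delta>^2"
      using less.prems \<open>k < m\<close> by (intro mult_right_mono) auto
    finally have num: "\<bar>g k l - (\<Sum>r<l. chol g k r * chol g l r)\<bar> \<le> \<delta> * q"
      using off[of k l] less.prems \<open>k < m\<close> small by linarith
    have "\<bar>chol g k l\<bar> = \<bar>g k l - (\<Sum>r<l. chol g k r * chol g l r)\<bar> / chol g l l"
      using \<open>q \<le> chol g l l\<close> q by (simp add: chol_below[OF less.prems] abs_divide)
    also have "\<dots> \<le> \<delta> * q / q"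
      by (rule frac_le) (use num \<open>q \<le> chol g l l\<close> q in auto)
    finally show ?case using q by simp
  qed
  have "(\<Sum>r<k. (chol g k r)^2) \<le> real k * \<delta>^2"
    using abs_sum_mult_le[of k "chol g k" \<delta> "chol g k"] low by (simp add: power2_eq_square)
  also have "\<dots> \<le> real m * \<delta>^2"
    using \<open>k < m\<close> by (intro mult_right_mono) auto
  finally have "chol_pivot g k \<ge> q^2"
    using diag[of k] \<open>k < m\<close> room by (simp add: chol_pivot_def)
  with low show ?case by simp
qed

lemma isCont_chol_pivot:
  fixes G :: "'a::t2_space \<Rightarrow> nat \<Rightarrow> nat \<Rightarrow> real"
  assumes fixed: "\<And>t a b. a < k \<Longrightarrow> b < k \<Longrightarrow> G t a b = g a b"
    and cont: "\<And>l. l \<le> k \<Longrightarrow> isCont (\<lambda>t. G t k l) x"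
    and nonzero: "\<And>l. l < k \<Longrightarrow> chol g l l \<noteq> 0"
  shows "isCont (\<lambda>t. chol_pivot (G t) k) x"
proof -
  have earlier_rows: "chol (G t) l r = chol g l r" if "l < k" for t l r
    using that by (intro chol_cong[of "k - 1"]) (auto intro: fixed)
  have "isCont (\<lambda>t. chol (G t) k l) x" if "l < k" for l
    using that
  proof (induction l rule: less_induct)
    case (less l)
    have "chol (G t) k l = (G t k l - (\<Sum>r<l. chol (G t) k r * chol g l r)) / chol g l l" for t
      using earlier_rows[of l t] less.prems by (simp add: chol_below[OF less.prems])
    then show ?case
      using less cont[of l] nonzero[of l] by (simp only:) (intro continuous_intros; simp)
  qed
  then show ?thesis
    unfolding chol_pivot_def using cont[of k] by (intro continuous_intros) auto
qed

subsection \<open>\<U>-centering\<close>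

lemma ucenter_cong:
  assumes "\<And>i j. i < n \<Longrightarrow> j < n \<Longrightarrow> A i j = B i j"
  shows "ucenter n A = ucenter n B"
  using assms by (intro ext) (simp add: ucenter_def)

lemma ucenter_add:
  "ucenter n (\<lambda>i j. A i j + B i j) = (\<lambda>i j. ucenter n A i j + ucenter n B i j)"
  by (intro ext) (simp add: ucenter_def sum.distrib add_divide_distrib)

lemma ucenter_sum:
  "ucenter n (\<lambda>i j. \<Sum>t<m. c t * B t i j) = (\<lambda>i j. \<Sum>t<m. c t * ucenter n (B t) i j)"
proof (intro ext)
  fix i j
  show "ucenter n (\<lambda>i j. \<Sum>t<m. c t * B t i j) i j = (\<Sum>t<m. c t * ucenter n (B t) i j)"
  proof (cases "i < n \<and> j < n \<and> i \<noteq> j")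
    case True
    have "(\<Sum>t<m. c t * ucenter n (B t) i j) = (\<Sum>t<m. c t * B t i j
      - (\<Sum>l<n. c t * B t i l) / (real n - 2) - (\<Sum>k<n. c t * B t k j) / (real n - 2)
      + (\<Sum>k<n. \<Sum>l<n. c t * B t k l) / ((real n - 1) * (real n - 2)))"
      using True by (intro sum.cong) (simp_all add: ucenter_def sum_distrib_left algebra_simps)
    also have "\<dots> = ucenter n (\<lambda>i j. \<Sum>t<m. c t * B t i j) i j"
      using True unfolding ucenter_def
      by (simp add: sum.distrib sum_subtractf sum_divide_distrib[symmetric] sum.swap[of _ "{..<m}"])
    finally show ?thesis by simp
  qed (auto simp: ucenter_def)
qed

lemma sum_lessThan_skip:
  fixes f :: "nat \<Rightarrow> 'a::ab_group_add"
  assumes "i < n"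
  shows "(\<Sum>l<n. if i = l then 0 else f l) = (\<Sum>l<n. f l) - f i"
  using assms by (simp add: sum.remove[of "{..<n}" i] sum.If_cases Diff_eq)

lemma ucenter_additive_zero:
  assumes "3 \<le> n"
  shows "ucenter n (\<lambda>i j. if i = j then 0 else c + x i + x j) = (\<lambda>i j. 0)"
proof (intro ext)
  fix i j
  define X where "X = (\<Sum>l<n. x l)"
  have row: "(\<Sum>l<n. if i = l then 0 else c + x i + x l) = (real n - 1) * c + (real n - 2) * x i + X"
    if "i < n" for i
    using sum_lessThan_skip[OF that, of "\<lambda>l. c + x i + x l"]
    by (simp add: sum.distrib X_def algebra_simps)
  have col: "(\<Sum>k<n. if k = j then 0 else c + x k + x j) = (real n - 1) * c + (real n - 2) * x j + X"
    if "j < n" for j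
    using row[OF that] by (simp add: eq_commute[of _ j] add.commute add.left_commute cong: if_cong)
  have total: "(\<Sum>k<n. \<Sum>l<n. if k = l then 0 else c + x k + x l)
      = real n * (real n - 1) * c + 2 * (real n - 1) * X"
  proof -
    have "(\<Sum>k<n. \<Sum>l<n. if k = l then 0 else c + x k + x l)
        = (\<Sum>k<n. (real n - 1) * c + (real n - 2) * x k + X)"
      by (intro sum.cong) (simp_all add: row)
    also have "\<dots> = real n * (real n - 1) * c + 2 * (real n - 1) * X"
      by (simp add: sum.distrib sum_distrib_left[symmetric] flip: X_def) (simp add: algebra_simps)
    finally show ?thesis .
  qed
  have "real n - 2 \<noteq> 0" "real n - 1 \<noteq> 0" using assms by auto
  show "ucenter n (\<lambda>i j. if i = j then 0 else c + x i + x j) i j = 0"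
  proof (cases "i < n \<and> j < n \<and> i \<noteq> j")
    case True
    then have "i < n" "j < n" by auto
    have cancel: "(real n * (real n - 1) * c + 2 * (real n - 1) * X) / ((real n - 1) * (real n - 2))
        = (real n * c + 2 * X) / (real n - 2)"
    proof -
      have "real n * (real n - 1) * c + 2 * (real n - 1) * X = (real n - 1) * (real n * c + 2 * X)"
        by (simp add: algebra_simps)
      then show ?thesis
        by (simp only: mult_divide_mult_cancel_left[OF \<open>real n - 1 \<noteq> 0\<close>])
    qed
    have "((real n - 1) * c + (real n - 2) * x i + X) + ((real n - 1) * c + (real n - 2) * x j + X)
        - (real n * c + 2 * X) = (real n - 2) * (c + x i + x j)"
      by (simp add: algebra_simps)
    then have "((real n - 1) * c + (real n - 2) * x i + X) / (real n - 2)
        + ((real n - 1) * c + (real n - 2) * x j + X) / (real n - 2)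
        - (real n * c + 2 * X) / (real n - 2) = c + x i + x j"
      using \<open>real n - 2 \<noteq> 0\<close>
      by (simp only: add_divide_distrib[symmetric] diff_divide_distrib[symmetric]) simp
    then show ?thesis
      unfolding ucenter_def if_P[OF True] row[OF \<open>i < n\<close>] col[OF \<open>j < n\<close>] total cancel
      using True by simp
  qed (auto simp: ucenter_def)
qed

lemma ucenter_shift_invariant:
  assumes "3 \<le> n" and "\<And>i. i < n \<Longrightarrow> A i i = 0"
  shows "ucenter n (\<lambda>i j. if i = j then 0 else A i j + c + x i + x j) = ucenter n A"
proof -
  have "ucenter n (\<lambda>i j. if i = j then 0 else A i j + c + x i + x j)
      = ucenter n (\<lambda>i j. A i j + (if i = j then 0 else c + x i + x j))"
    using assms(2) by (intro ucenter_cong) auto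
  then show ?thesis by (simp add: ucenter_add ucenter_additive_zero[OF assms(1)])
qed

subsection \<open>Distance matrices from Gram matrices\<close>

text \<open>The Gram matrix \<open>\<langle>v\<^sub>i - v\<^sub>b, v\<^sub>j - v\<^sub>b\<rangle>\<close> of points with mutual distances \<open>D\<close>, by polarization.\<close>

definition gram_at :: "(nat \<Rightarrow> nat \<Rightarrow> real) \<Rightarrow> nat \<Rightarrow> nat \<Rightarrow> nat \<Rightarrow> real" where
  "gram_at D b i j = ((D i b)^2 + (D j b)^2 - (D i j)^2) / 2"

lemma edist_eq_if_gram:
  assumes gram: "\<And>i j. i \<le> m \<Longrightarrow> j \<le> m \<Longrightarrow> (\<Sum>r<d. v i r * v j r) = gram_at D m i j"
    and diag: "\<And>i. D i i = 0" and "0 \<le> D i j" and "i \<le> m" "j \<le> m"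
  shows "edist d (v i) (v j) = D i j"
proof -
  have "(\<Sum>r<d. (v i r - v j r)^2)
      = (\<Sum>r<d. v i r * v i r) + (\<Sum>r<d. v j r * v j r) - 2 * (\<Sum>r<d. v i r * v j r)"
    by (simp add: power2_eq_square algebra_simps sum.distrib sum_subtractf sum_distrib_left)
  also have "\<dots> = (D i j)^2"
    using gram[of i i] gram[of j j] gram[of i j] assms(4,5) by (simp add: gram_at_def diag)
  finally show ?thesis using \<open>0 \<le> D i j\<close> by (simp add: edist_def)
qed

lemma sqrt_2_bounds: "5/4 \<le> sqrt (2::real)" "sqrt (2::real) \<le> 3/2"
  by (rule real_le_rsqrt, simp add: power2_eq_square, rule real_le_lsqrt, simp_all add: power2_eq_square)

lemma gram_entry_bound:
  fixes a b e s M :: real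
  assumes "\<bar>a\<bar> \<le> M" "\<bar>b\<bar> \<le> M" "\<bar>e\<bar> \<le> M" "M \<le> s"
  shows "\<bar>((a + s)^2 + (b + s)^2 - (e + sqrt 2 * s)^2) / 2\<bar> \<le> 5 * s * M"
proof -
  have expand: "((a + s)^2 + (b + s)^2 - (e + sqrt 2 * s)^2) / 2
      = s * (a + b - sqrt 2 * e) + (a^2 + b^2 - e^2) / 2"
    by (simp add: power2_eq_square field_simps)
  have "\<bar>sqrt 2 * e\<bar> \<le> 3/2 * M"
    using mult_mono[OF sqrt_2_bounds(2) assms(3)] by (simp add: abs_mult)
  then have linear: "\<bar>a + b - sqrt 2 * e\<bar> \<le> 4 * M"
    using assms(1,2) by linarith
  have "\<bar>a\<bar>^2 \<le> M^2" "\<bar>b\<bar>^2 \<le> M^2" "\<bar>e\<bar>^2 \<le> M^2"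
    using assms(1-3) by (metis abs_ge_zero power_mono)+
  then have "a^2 \<le> M^2" "b^2 \<le> M^2" "e^2 \<le> M^2" by simp_all
  then have "a^2 + b^2 - e^2 \<le> 2 * M^2" "e^2 - (a^2 + b^2) \<le> 2 * M^2"
    using zero_le_power2[of a] zero_le_power2[of b] zero_le_power2[of e] by linarith+
  then have quadratic: "\<bar>(a^2 + b^2 - e^2) / 2\<bar> \<le> M * M"
    by (simp add: power2_eq_square abs_le_iff)
  have "0 \<le> M" using assms(1) by linarith
  then have "0 \<le> s" "M * M \<le> s * M" using assms(4) by (auto intro: mult_right_mono)
  then have "\<bar>s * (a + b - sqrt 2 * e)\<bar> \<le> s * (4 * M)"
    using linear by (simp add: abs_mult mult_left_mono)
  then show ?thesis
    unfolding expand
    using quadratic \<open>M * M \<le> s * M\<close>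
      abs_triangle_ineq[of "s * (a + b - sqrt 2 * e)" "(a^2 + b^2 - e^2) / 2"]
    by linarith
qed

subsection \<open>Shifting a symmetric matrix into a distance matrix\<close>

locale shifted_distances =
  fixes A :: "nat \<Rightarrow> nat \<Rightarrow> real" and m :: nat
  assumes A_sym: "A i j = A j i" and A_diag: "A i i = 0" and three_le_m: "3 \<le> m"
begin

definition M :: real where "M = (\<Sum>a\<le>m. \<Sum>b\<le>m. \<bar>A a b\<bar>)"

definition \<delta> :: real where "\<delta> = 15 * M + 1"

definition s :: real where "s = 8 * real m * \<delta>^2 + 8 * M + 1"

text \<open>The shifts make \<open>D 0 i m = A i m + s\<close> and \<open>D 0 i j = A i j + sqrt 2 * s\<close> for distinct
  \<open>i, j < m\<close>: the vertex distances of a right-angled isosceles simplex with corner \<open>m\<close> and leg \<open>s\<close>,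
  perturbed by \<open>A\<close>. Increasing \<open>t\<close> moves vertex \<open>m - 1\<close> towards the corner.\<close>

definition shift :: "real \<Rightarrow> nat \<Rightarrow> real" where
  "shift t i = (if i = m then s - sqrt 2 * s else if i = m - 1 then - t else 0)"

definition D :: "real \<Rightarrow> nat \<Rightarrow> nat \<Rightarrow> real" where
  "D t i j = (if i = j then 0 else A i j + sqrt 2 * s + shift t i + shift t j)"

definition G :: "real \<Rightarrow> nat \<Rightarrow> nat \<Rightarrow> real" where
  "G t = gram_at (D t) m"

lemma A_bound: "i \<le> m \<Longrightarrow> j \<le> m \<Longrightarrow> \<bar>A i j\<bar> \<le> M"
  unfolding M_def
  by (rule order_trans[OF member_le_sum member_le_sum[of i]]) (auto intro: sum_nonneg)

lemma M_nonneg: "0 \<le> M"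
  using A_bound[of 0 0] by simp

lemma s_bounds: "1 \<le> s" "8 * M \<le> s" "8 * real m * \<delta>^2 \<le> s"
  using M_nonneg by (auto simp: s_def)

lemma D_diag: "D t i i = 0"
  by (simp add: D_def)

lemma D_sym: "D t i j = D t j i"
  by (simp add: D_def A_sym)

lemma G_sym: "G t i j = G t j i"
  by (simp add: G_def gram_at_def D_sym)

lemma G_eq_G0: "a < m - 1 \<Longrightarrow> b < m - 1 \<Longrightarrow> G t a b = G 0 a b"
  by (simp add: G_def gram_at_def D_def shift_def)

lemma G_continuous: "isCont (\<lambda>t. G t i j) x"
proof -
  have "isCont (\<lambda>t. shift t i) x" for i
    unfolding shift_def by (cases "i = m"; cases "i = m - 1") simp_all
  then have "isCont (\<lambda>t. D t i j) x" for i j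
    unfolding D_def by (cases "i = j") (simp_all add: continuous_intros)
  then show ?thesis
    by (simp add: G_def gram_at_def)
qed

lemma shift_zero: "i < m \<Longrightarrow> shift 0 i = 0"
  by (simp add: shift_def)

lemma D_to_base: "i < m \<Longrightarrow> D t i m = A i m + s + shift t i"
  by (simp add: D_def shift_def)

lemma G0_diag:
  assumes "i < m"
  shows "s^2 / 4 \<le> G 0 i i"
proof -
  have "s / 2 \<le> A i m + s"
    using A_bound[of i m] assms s_bounds by (simp add: abs_le_iff)
  then have "(s / 2)^2 \<le> (A i m + s)^2"
    using s_bounds by (intro power_mono) auto
  then show ?thesis
    using assms by (simp add: G_def gram_at_def D_to_base shift_zero D_diag power_divide)
qed

lemma G0_offdiag:
  assumes "i < m" "j < m" "i \<noteq> j"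
  shows "\<bar>G 0 i j\<bar> \<le> 5 * s * M"
proof -
  have "D 0 i j = A i j + sqrt 2 * s"
    using assms by (simp add: D_def shift_def)
  then have "G 0 i j = ((A i m + s)^2 + (A j m + s)^2 - (A i j + sqrt 2 * s)^2) / 2"
    using assms by (simp add: G_def gram_at_def D_to_base shift_zero)
  then show ?thesis
    by (simp only:) (rule gram_entry_bound; use assms A_bound s_bounds M_nonneg in auto)
qed

lemma G0_pivot_lower: "k < m \<Longrightarrow> (s / 3)^2 \<le> chol_pivot (G 0) k"
proof (rule conjunct1[OF chol_diag_dominant[where \<delta> = \<delta>]])
  have small: "real m * \<delta>^2 \<le> s / 8"
    using s_bounds by simp
  moreover have "s \<le> s^2"
    using s_bounds mult_left_mono[of 1 s s] by (simp add: power2_eq_square)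
  ultimately show "real m * \<delta>^2 \<le> s^2 / 4 - (s / 3)^2"
    using s_bounds by (simp add: power_divide)
  show "5 * s * M + real m * \<delta>^2 \<le> \<delta> * (s / 3)"
    using small s_bounds by (simp add: \<delta>_def algebra_simps)
qed (use G0_diag G0_offdiag s_bounds in auto)

lemma G_pivot_pos:
  assumes "l < m - 1"
  shows "0 < chol_pivot (G t) l"
proof -
  have "chol_pivot (G t) l = chol_pivot (G 0) l"
    using assms by (intro chol_pivot_cong[of "m - 2"] G_eq_G0) auto
  moreover have "(s / 3)^2 \<le> chol_pivot (G 0) l"
    using assms by (intro G0_pivot_lower) simp
  moreover have "0 < (s / 3)^2"
    using s_bounds by simp
  ultimately show ?thesis
    by linarith
qed

lemma last_pivot_vanishes: "\<exists>t\<ge>0. t \<le> s + A (m - 1) m \<and> chol_pivot (G t) (m - 1) = 0"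
proof -
  define t\<^sub>1 where "t\<^sub>1 = s + A (m - 1) m"
  have "0 \<le> t\<^sub>1"
    using A_bound[of "m - 1" m] s_bounds M_nonneg by (simp add: t\<^sub>1_def abs_le_iff)
  have "D t\<^sub>1 (m - 1) m = 0"
    using three_le_m by (simp add: D_def shift_def t\<^sub>1_def)
  then have "chol_pivot (G t\<^sub>1) (m - 1) \<le> 0"
    by (simp add: chol_pivot_def G_def gram_at_def D_diag sum_nonneg)
  moreover have "(s / 3)^2 \<le> chol_pivot (G 0) (m - 1)"
    using three_le_m by (intro G0_pivot_lower) simp
  then have "0 \<le> chol_pivot (G 0) (m - 1)"
    using zero_le_power2[of "s / 3"] by linarith
  moreover have "isCont (\<lambda>t. chol_pivot (G t) (m - 1)) t" for t
  proof (rule isCont_chol_pivot)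
    show "G t a b = G 0 a b" if "a < m - 1" "b < m - 1" for t a b
      using that by (rule G_eq_G0)
    show "chol (G 0) l l \<noteq> 0" if "l < m - 1" for l
      using G_pivot_pos[OF that, of 0] by (simp add: chol_diag)
  qed (rule G_continuous)
  ultimately show ?thesis
    using IVT2[of "\<lambda>t. chol_pivot (G t) (m - 1)" t\<^sub>1 0 0] \<open>0 \<le> t\<^sub>1\<close> by (auto simp: t\<^sub>1_def)
qed

lemma D_nonneg:
  assumes "0 \<le> t" "t \<le> s + A (m - 1) m" "i \<le> m" "j \<le> m"
  shows "0 \<le> D t i j"
proof -
  have A_lower: "- M \<le> A a b" if "a \<le> m" "b \<le> m" for a b
    using A_bound[OF that] by (simp add: abs_le_iff)
  have to_base: "0 \<le> D t k m" if "k < m" for k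
  proof (cases "k = m - 1")
    case True
    then show ?thesis
      using that assms(2) by (simp add: D_to_base shift_def)
  next
    case False
    then show ?thesis
      using that A_lower[of k m] s_bounds M_nonneg by (simp add: D_to_base shift_def)
  qed
  have inner: "0 \<le> D t a b" if "a < m" "b < m" "a \<noteq> b" for a b
  proof -
    have "- t \<le> shift t a + shift t b"
      using that assms(1) by (auto simp: shift_def)
    moreover have "5/4 * s \<le> sqrt 2 * s"
      using sqrt_2_bounds(1) s_bounds by (intro mult_right_mono) auto
    moreover have "A (m - 1) m \<le> M"
      using A_bound[of "m - 1" m] by (simp add: abs_le_iff)
    moreover have "- M \<le> A a b"
      using that by (intro A_lower) auto
    ultimately show ?thesis
      using that assms(2) s_bounds by (simp only: D_def if_False)
  qed
  show ?thesis
    using assms(3,4) to_base[of i] to_base[of j] inner[of i j] D_sym[of t m] D_diag[of t]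
    by (cases "i = j"; cases "i = m"; cases "j = m") auto
qed

lemma D_realizable: "\<exists>t v. \<forall>i\<le>m. \<forall>j\<le>m. edist (m - 1) (v i) (v j) = D t i j"
proof -
  obtain t where t: "0 \<le> t" "t \<le> s + A (m - 1) m" "chol_pivot (G t) (m - 1) = 0"
    using last_pivot_vanishes by blast
  define v where "v i r = (if i < m then chol (G t) i r else 0)" for i r
  have gram: "(\<Sum>r<m - 1. v i r * v j r) = gram_at (D t) m i j" if "i \<le> m" "j \<le> m" for i j
  proof (cases "i < m \<and> j < m")
    case True
    have "chol (G t) j (m - 1) = 0"
      using True t(3) by (cases "j = m - 1") (auto simp: chol_diag chol_above)
    then have "(\<Sum>r<m - 1. v i r * v j r) = (\<Sum>r<Suc (m - 1). chol (G t) i r * chol (G t) j r)"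
      unfolding sum.lessThan_Suc using True by (simp add: v_def)
    also have "\<dots> = G t i j"
      by (rule chol_gram[OF G_sym G_pivot_pos]) (use t True in auto)
    finally show ?thesis
      by (simp add: G_def)
  next
    case False
    then have "i = m \<or> j = m"
      using that by auto
    then show ?thesis
      using False by (auto simp: v_def gram_at_def D_diag D_sym)
  qed
  have "edist (m - 1) (v i) (v j) = D t i j" if "i \<le> m" "j \<le> m" for i j
    using that by (intro edist_eq_if_gram[OF gram D_diag D_nonneg[OF t(1,2)]])
  then show ?thesis
    by blast
qed

end

lemma Hspace_ucenter:
  assumes "H \<in> Hspace n"
  obtains A where "\<And>i j. A i j = A j i" "\<And>i. A i i = 0" "H = ucenter n A"
proof -
  obtain m :: nat and c p V where H: "H = (\<lambda>i j. \<Sum>t<m. c t * ucenter n (dist_matrix (p t) (V t)) i j)"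
    using assms unfolding Hspace_def by blast
  define A where "A i j = (\<Sum>t<m. c t * dist_matrix (p t) (V t) i j)" for i j
  have "A i j = A j i" for i j
    unfolding A_def dist_matrix_def edist_def by (simp add: power2_commute)
  moreover have "A i i = 0" for i
    by (simp add: A_def dist_matrix_def edist_def)
  moreover have "H = ucenter n A"
    unfolding H A_def by (simp add: ucenter_sum)
  ultimately show ?thesis
    using that by blast
qed

theorem theorem2:
  fixes n :: nat and H :: "nat \<Rightarrow> nat \<Rightarrow> real"
  assumes "4 \<le> n" and "H \<in> Hspace n"
  shows "\<exists>(d::nat) (v::nat \<Rightarrow> nat \<Rightarrow> real). 1 \<le> d \<and> d \<le> n - 2 \<and>
           ucenter n (dist_matrix d v) = H"
proof -
  obtain A where A_sym: "\<And>i j. A i j = A j i" and A_diag: "\<And>i. A i i = 0"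
    and H: "H = ucenter n A"
    using Hspace_ucenter[OF assms(2)] by blast
  define m where "m = n - 1"
  have n: "n = Suc m" "m - 1 = n - 2"
    using assms(1) by (auto simp: m_def)
  interpret shifted_distances A m
    using assms(1) A_sym A_diag by unfold_locales (auto simp: m_def)
  obtain t v where v: "\<And>i j. i \<le> m \<Longrightarrow> j \<le> m \<Longrightarrow> edist (n - 2) (v i) (v j) = D t i j"
    using D_realizable n(2) by metis
  have "ucenter n (dist_matrix (n - 2) v) = ucenter n (D t)"
    using v n(1) by (intro ucenter_cong) (simp add: dist_matrix_def)
  also have "D t = (\<lambda>i j. if i = j then 0 else A i j + sqrt 2 * s + shift t i + shift t j)"
    by (intro ext) (simp add: D_def)
  also have "ucenter n \<dots> = ucenter n A"
    using assms(1) A_diag by (intro ucenter_shift_invariant) auto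
  finally show ?thesis
    using assms(1) H by (intro exI[of _ "n - 2"]) auto
qed

end
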